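(* Let $C$ be a normal, closed cone with nonempty interior in a real Banach space. Let $f:\operatorname{int} C\to\operatorname{int} C$ be $d_T$-nonexpansive and either $\gamma$-condensing or $\tau$-condensing. If $f$ has a fixed point in $\operatorname{int} C$, then for any $0<\alpha<1$ and any $x_0\in\operatorname{int} C$, the sequence defined by $x_{n+1}=\alpha f(x_n)+(1-\alpha)x_n$ converges to a fixed point of $f$.
   Context: A closed cone $C$ (closed convex, $\lambda C\subseteq C$ for $\lambda\ge0$, $C\cap(-C)=\{0\}$) induces the order $x\le y$ iff $y-x\in C$. $C$ is normal if there is $\kappa$ with $\|x\|\le\kappa\|y\|$ whenever $0\le x\le y$. Thompson's metric on $\operatorname{int}C$: $d_T(x,y)=\log\inf\{\beta\ge1:\beta^{-1}x\le y\le\beta x\}$; $f$ is $d_T$-nonexpansive if $d_T(f(x),f(y))\le d_T(x,y)$. For norm-bounded $A$, $\gamma(A)=\inf\{d>0: A$ has a finite cover by sets of norm diameter $\le d\}$; for $d_T$-bounded $A\subseteq\operatorname{int}C$, $\tau(A)$ is defined likewise with $d_T$-diameter. A continuous map $f$ is $\gamma$-condensing (resp. $\tau$-condensing) if $\gamma(f(A))<\gamma(A)$ for every bounded $A$ in its domain with $\gamma(A)>0$ (resp. $\tau(f(A))<\tau(A)$ for every $d_T$-bounded $A$ with $\tau(A)>0$). *)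

theory Defs
  imports "HOL-Analysis.Analysis"
begin

definition closed_cone :: "'a::real_normed_vector set \<Rightarrow> bool" where
  "closed_cone C \<longleftrightarrow> closed C \<and> convex C \<and> (\<forall>x\<in>C. \<forall>l::real. l \<ge> 0 \<longrightarrow> l *\<^sub>R x \<in> C)
     \<and> C \<inter> uminus ` C = {0}"

definition cone_le :: "'a::real_normed_vector set \<Rightarrow> 'a \<Rightarrow> 'a \<Rightarrow> bool" where
  "cone_le C x y \<longleftrightarrow> y - x \<in> C"

definition normal_cone :: "'a::real_normed_vector set \<Rightarrow> bool" where
  "normal_cone C \<longleftrightarrow> (\<exists>\<kappa>::real. \<forall>x y. cone_le C 0 x \<and> cone_le C x y \<longrightarrow> norm x \<le> \<kappa> * norm y)"

definition thompson :: "'a::real_normed_vector set \<Rightarrow> 'a \<Rightarrow> 'a \<Rightarrow> real" where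
  "thompson C x y = ln (Inf {\<beta>::real. \<beta> \<ge> 1 \<and> cone_le C (inverse \<beta> *\<^sub>R x) y \<and> cone_le C y (\<beta> *\<^sub>R x)})"

definition thompson_nonexpansive :: "'a::real_normed_vector set \<Rightarrow> ('a \<Rightarrow> 'a) \<Rightarrow> bool" where
  "thompson_nonexpansive C f \<longleftrightarrow>
     (\<forall>x\<in>interior C. \<forall>y\<in>interior C. thompson C (f x) (f y) \<le> thompson C x y)"

definition norm_diam :: "'a::real_normed_vector set \<Rightarrow> ereal" where
  "norm_diam S = (SUP p\<in>S \<times> S. ereal (dist (fst p) (snd p)))"

definition thompson_diam :: "'a::real_normed_vector set \<Rightarrow> 'a set \<Rightarrow> ereal" where
  "thompson_diam C S = (SUP p\<in>S \<times> S. ereal (thompson C (fst p) (snd p)))"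

text \<open>Kuratowski measure of noncompactness (value \<infinity> if no finite cover exists,
  i.e. for unbounded sets).\<close>
definition kur_gamma :: "'a::real_normed_vector set \<Rightarrow> ereal" where
  "kur_gamma A = Inf {ereal d | d. d > 0 \<and>
     (\<exists>F. finite F \<and> A \<subseteq> \<Union>F \<and> (\<forall>S\<in>F. norm_diam S \<le> ereal d))}"

definition kur_tau :: "'a::real_normed_vector set \<Rightarrow> 'a set \<Rightarrow> ereal" where
  "kur_tau C A = Inf {ereal d | d. d > 0 \<and>
     (\<exists>F. finite F \<and> A \<subseteq> \<Union>F \<and> (\<forall>S\<in>F. S \<subseteq> interior C \<and> thompson_diam C S \<le> ereal d))}"

definition thompson_bounded :: "'a::real_normed_vector set \<Rightarrow> 'a set \<Rightarrow> bool" where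
  "thompson_bounded C A \<longleftrightarrow> A \<subseteq> interior C \<and>
     (\<exists>M. \<forall>x\<in>A. \<forall>y\<in>A. thompson C x y \<le> M)"

definition gamma_condensing :: "'a::real_normed_vector set \<Rightarrow> ('a \<Rightarrow> 'a) \<Rightarrow> bool" where
  "gamma_condensing C f \<longleftrightarrow> continuous_on (interior C) f \<and>
     (\<forall>A. A \<subseteq> interior C \<and> bounded A \<and> kur_gamma A > 0 \<longrightarrow> kur_gamma (f ` A) < kur_gamma A)"

definition tau_condensing :: "'a::real_normed_vector set \<Rightarrow> ('a \<Rightarrow> 'a) \<Rightarrow> bool" where
  "tau_condensing C f \<longleftrightarrow> continuous_on (interior C) f \<and>
     (\<forall>A. thompson_bounded C A \<and> kur_tau C A > 0 \<longrightarrow> kur_tau C (f ` A) < kur_tau C A)"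

end

theory Submission
  imports Defs
begin

text \<open>
  Convexity of the cone makes the averaged map \<open>g = \<alpha> f + (1 - \<alpha>) id\<close> nonexpansive for
  Thompson's metric, so the orbit stays at bounded distance from a fixed point. The measure of
  noncompactness of the orbit would strictly decrease under \<open>g\<close> if it were positive, although
  the orbit and its image under \<open>g\<close> differ by one point; hence the orbit is precompact. For
  Thompson's metric the strict decrease is not immediate, since averaging only bounds a distance
  by the maximum of the two; it comes from the fact that all points involved are comparable
  up to a common factor.

  The distance between consecutive iterates tends to \<open>0\<close>: if \<open>x\<^sub>j\<^sub>+\<^sub>1 \<le> \<beta> x\<^sub>j\<close> for all \<open>j\<close>, the gaps
  \<open>b\<^sub>j = \<beta> x\<^sub>j - x\<^sub>j\<^sub>+\<^sub>1\<close> satisfy \<open>b\<^sub>j\<^sub>+\<^sub>1 \<ge> (1 - \<alpha>) b\<^sub>j\<close>, and a weighted sum of them telescopes to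
  \<open>\<beta>\<^sup>N\<^sup>+\<^sup>1 x\<^sub>0 - x\<^sub>N\<^sub>+\<^sub>1\<close>. For large \<open>N\<close> this dominates a multiple of \<open>x\<^sub>0\<close> by boundedness, so
  the last gap is bounded below and \<open>\<beta>\<close> can be decreased by a fixed amount. Therefore a
  limit point of the orbit is a fixed point, and the distance to it decreases along the orbit.
\<close>

text \<open>For interior points and \<open>\<beta> \<ge> 1\<close> this says that the Thompson distance is at most \<open>ln \<beta>\<close>.\<close>

definition order_close :: "'a::real_normed_vector set \<Rightarrow> real \<Rightarrow> 'a \<Rightarrow> 'a \<Rightarrow> bool" where
  "order_close C \<beta> x y \<longleftrightarrow> \<beta> *\<^sub>R y - x \<in> C \<and> \<beta> *\<^sub>R x - y \<in> C"

lemma order_close_commute: "order_close C \<beta> x y \<longleftrightarrow> order_close C \<beta> y x"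
  by (auto simp: order_close_def)

section \<open>Closed cones\<close>

locale cone_order =
  fixes C :: "'a::real_normed_vector set"
  assumes closed_cone: "closed_cone C"
begin

lemma closed: "closed C"
  using closed_cone by (simp add: closed_cone_def)

lemma scale_mem: "x \<in> C \<Longrightarrow> 0 \<le> l \<Longrightarrow> l *\<^sub>R x \<in> C"
  using closed_cone by (simp add: closed_cone_def)

lemma zero_mem: "0 \<in> C"
  using closed_cone by (auto simp: closed_cone_def)

lemma add_mem:
  assumes "x \<in> C" "y \<in> C"
  shows "x + y \<in> C"
proof -
  have "convex C"
    using closed_cone by (simp add: closed_cone_def)
  then have "(1/2) *\<^sub>R x + (1/2) *\<^sub>R y \<in> C"
    using assms by (simp add: convex_def)
  then have "2 *\<^sub>R ((1/2) *\<^sub>R x + (1/2) *\<^sub>R y) \<in> C"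
    by (rule scale_mem) simp
  then show ?thesis
    by (simp add: scaleR_add_right)
qed

lemma sum_mem: "(\<And>i. i \<in> I \<Longrightarrow> g i \<in> C) \<Longrightarrow> sum g I \<in> C"
  by (induction I rule: infinite_finite_induct) (auto simp: zero_mem add_mem)

text \<open>A ball of radius \<open>e\<close> around \<open>p\<close> yields the constant
  \<open>2 / e\<close> by scaling, and a constant \<open>M\<close> yields a ball of radius
  \<open>1 / M\<close>. Questions about the interior thereby become inequalities in the
  order.\<close>

lemma interior_iff_order_unit:
  "p \<in> interior C \<longleftrightarrow> (\<exists>M>0. \<forall>v. (M * norm v) *\<^sub>R p - v \<in> C)"
proof
  assume "p \<in> interior C"
  then obtain e where e: "e > 0" "ball p e \<subseteq> C"
    by (auto simp: mem_interior)
  have "(2 / e * norm v) *\<^sub>R p - v \<in> C" for v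
  proof (cases "v = 0")
    case False
    have "p - (e / (2 * norm v)) *\<^sub>R v \<in> ball p e"
      using False e by (simp add: dist_norm)
    then have "(2 / e * norm v) *\<^sub>R (p - (e / (2 * norm v)) *\<^sub>R v) \<in> C"
      using e by (intro scale_mem) auto
    then show ?thesis
      using False e by (simp add: scaleR_diff_right)
  qed (simp add: zero_mem)
  with e show "\<exists>M>0. \<forall>v. (M * norm v) *\<^sub>R p - v \<in> C"
    by (intro exI[of _ "2 / e"]) auto
next
  assume "\<exists>M>0. \<forall>v. (M * norm v) *\<^sub>R p - v \<in> C"
  then obtain M where M: "M > 0" "\<And>v. (M * norm v) *\<^sub>R p - v \<in> C"
    by blast
  have pos: "M * norm p + 1 > 0"
    using M(1) by (simp add: add_nonneg_pos)
  \<comment> \<open>The choice \<open>v = - p\<close> puts a positive multiple of \<open>p\<close>,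
    hence \<open>p\<close> itself, into the cone.\<close>
  have "(M * norm p + 1) *\<^sub>R p \<in> C"
    using M(2)[of "- p"] by (simp add: scaleR_add_left)
  from scale_mem[OF this, of "inverse (M * norm p + 1)"] have p: "p \<in> C"
    using pos by simp
  have "y \<in> C" if "y \<in> ball p (1 / M)" for y
  proof -
    have "M * norm (p - y) \<le> 1"
      using that M by (simp add: dist_norm field_simps)
    then have "(1 - M * norm (p - y)) *\<^sub>R p + ((M * norm (p - y)) *\<^sub>R p - (p - y)) \<in> C"
      using M p by (intro add_mem scale_mem) auto
    then show ?thesis
      by (simp add: algebra_simps)
  qed
  then show "p \<in> interior C"
    using M by (auto simp: mem_interior intro!: exI[of _ "1 / M"])
qed

text \<open>An order unit constant \<open>M\<close> for \<open>p\<close> becomes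
  \<open>M / l\<close> for any point above \<open>l\<close> times \<open>p\<close>.\<close>

lemma interior_upward:
  assumes "p \<in> interior C" "0 < l" "q - l *\<^sub>R p \<in> C"
  shows "q \<in> interior C"
proof -
  obtain M where M: "M > 0" "\<And>v. (M * norm v) *\<^sub>R p - v \<in> C"
    using assms(1) interior_iff_order_unit by blast
  have "(M / l * norm v) *\<^sub>R q - v \<in> C" for v
  proof -
    have "(M / l * norm v) *\<^sub>R (q - l *\<^sub>R p) + ((M * norm v) *\<^sub>R p - v) \<in> C"
      using assms M by (intro add_mem scale_mem) auto
    then show ?thesis
      using assms by (simp add: algebra_simps)
  qed
  then show ?thesis
    unfolding interior_iff_order_unit using M assms by (intro exI[of _ "M / l"]) auto
qed

lemma interior_convex_comb:
  assumes "a \<in> interior C" "b \<in> interior C" "0 < \<alpha>" "\<alpha> < 1"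
  shows "\<alpha> *\<^sub>R a + (1 - \<alpha>) *\<^sub>R b \<in> interior C"
  using assms interior_subset[of C]
  by (intro interior_upward[OF assms(1,3)]) (auto intro!: scale_mem)

section \<open>Calculus of the relation \<open>order_close\<close>\<close>

lemma order_close_mono:
  assumes "order_close C \<beta> x y" "\<beta> \<le> \<beta>'" "x \<in> C" "y \<in> C"
  shows "order_close C \<beta>' x y"
proof -
  have "(\<beta>' - \<beta>) *\<^sub>R y + (\<beta> *\<^sub>R y - x) \<in> C" "(\<beta>' - \<beta>) *\<^sub>R x + (\<beta> *\<^sub>R x - y) \<in> C"
    using assms by (auto simp: order_close_def intro!: add_mem scale_mem)
  then show ?thesis
    by (simp add: order_close_def algebra_simps)
qed

text \<open>Factors multiply where distances add: this is the triangle inequality of Thompson's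
  metric.\<close>

lemma order_close_trans:
  assumes "order_close C \<beta> x y" "order_close C \<gamma> y z" "0 \<le> \<beta>" "0 \<le> \<gamma>"
  shows "order_close C (\<beta> * \<gamma>) x z"
proof -
  have "\<beta> *\<^sub>R (\<gamma> *\<^sub>R z - y) + (\<beta> *\<^sub>R y - x) \<in> C" "\<gamma> *\<^sub>R (\<beta> *\<^sub>R x - y) + (\<gamma> *\<^sub>R y - z) \<in> C"
    using assms by (auto simp: order_close_def intro!: add_mem scale_mem)
  then show ?thesis
    by (simp add: order_close_def algebra_simps)
qed

lemma order_close_convex_comb:
  assumes "order_close C \<beta> a a'" "order_close C \<beta> b b'" "0 \<le> \<alpha>" "\<alpha> \<le> 1"
  shows "order_close C \<beta> (\<alpha> *\<^sub>R a + (1 - \<alpha>) *\<^sub>R b) (\<alpha> *\<^sub>R a' + (1 - \<alpha>) *\<^sub>R b')"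
proof -
  have "\<alpha> *\<^sub>R (\<beta> *\<^sub>R a' - a) + (1 - \<alpha>) *\<^sub>R (\<beta> *\<^sub>R b' - b) \<in> C"
    "\<alpha> *\<^sub>R (\<beta> *\<^sub>R a - a') + (1 - \<alpha>) *\<^sub>R (\<beta> *\<^sub>R b - b') \<in> C"
    using assms by (auto simp: order_close_def intro!: add_mem scale_mem)
  then show ?thesis
    by (simp add: order_close_def algebra_simps)
qed

lemma order_close_interior_ex:
  assumes "x \<in> interior C" "y \<in> interior C"
  obtains \<beta> where "\<beta> \<ge> 1" "order_close C \<beta> x y"
proof -
  obtain M where M: "M > 0" "\<And>v. (M * norm v) *\<^sub>R x - v \<in> C"
    using assms(1) interior_iff_order_unit by blast
  obtain N where N: "N > 0" "\<And>v. (N * norm v) *\<^sub>R y - v \<in> C"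
    using assms(2) interior_iff_order_unit by blast
  define \<beta> where "\<beta> = max 1 (max (M * norm y) (N * norm x))"
  have "(\<beta> - M * norm y) *\<^sub>R x + ((M * norm y) *\<^sub>R x - y) \<in> C"
    "(\<beta> - N * norm x) *\<^sub>R y + ((N * norm x) *\<^sub>R y - x) \<in> C"
    using M N assms interior_subset by (auto simp: \<beta>_def intro!: add_mem scale_mem)
  then have "order_close C \<beta> x y"
    by (simp add: order_close_def algebra_simps)
  then show thesis
    by (intro that[of \<beta>]) (auto simp: \<beta>_def)
qed

text \<open>Near an interior point, norm closeness forces order closeness, because the point is an
  order unit.\<close>

lemma order_close_near:
  assumes "q \<in> interior C" "\<beta> > 1"
  obtains e where "e > 0" "\<And>x. dist x q < e \<Longrightarrow> order_close C \<beta> x q"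
proof -
  obtain M where M: "M > 0" "\<And>v. (M * norm v) *\<^sub>R q - v \<in> C"
    using assms(1) interior_iff_order_unit by blast
  have q: "q \<in> C"
    using assms interior_subset by auto
  \<comment> \<open>The radius is dictated by
    \<open>\<beta> x - q = (\<beta> - 1) q - \<beta> (q - x)\<close>, where the perturbation is
    magnified by \<open>\<beta>\<close>; the other inequality asks for less.\<close>
  have "order_close C \<beta> x q" if "dist x q < (\<beta> - 1) / (\<beta> * M)" for x
  proof -
    have *: "\<beta> * (M * norm (x - q)) \<le> \<beta> - 1"
      using that M assms by (simp add: dist_norm field_simps)
    moreover have "1 * (M * norm (x - q)) \<le> \<beta> * (M * norm (x - q))"
      using M assms by (intro mult_right_mono) auto
    ultimately have "(\<beta> - 1 - M * norm (x - q)) *\<^sub>R q + ((M * norm (x - q)) *\<^sub>R q - (x - q)) \<in> C"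
      using q by (intro add_mem scale_mem M) auto
    moreover have "(\<beta> - 1 - \<beta> * (M * norm (q - x))) *\<^sub>R q + \<beta> *\<^sub>R ((M * norm (q - x)) *\<^sub>R q - (q - x)) \<in> C"
      using q * assms by (intro add_mem scale_mem M) (auto simp: norm_minus_commute)
    ultimately show ?thesis
      by (simp add: order_close_def algebra_simps)
  qed
  then show thesis
    using assms M by (intro that[of "(\<beta> - 1) / (\<beta> * M)"]) auto
qed

section \<open>Thompson's metric in terms of the order\<close>

text \<open>The infimum in the metric is attained because \<open>C\<close> is closed, so later
  arguments can work with \<open>order_close\<close> instead of infima.\<close>

lemma thompson_le_ln_iff:
  assumes "x \<in> interior C" "y \<in> interior C" "\<beta> \<ge> 1"
  shows "thompson C x y \<le> ln \<beta> \<longleftrightarrow> order_close C \<beta> x y"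
proof -
  define S where "S = {\<beta>. \<beta> \<ge> 1 \<and> order_close C \<beta> x y}"
  have xy: "x \<in> C" "y \<in> C"
    using assms interior_subset by auto
  have scale: "y - inverse b *\<^sub>R x \<in> C \<longleftrightarrow> b *\<^sub>R y - x \<in> C" if "b \<ge> 1" for b
  proof
    assume "y - inverse b *\<^sub>R x \<in> C"
    then have "b *\<^sub>R (y - inverse b *\<^sub>R x) \<in> C"
      using that by (intro scale_mem) auto
    then show "b *\<^sub>R y - x \<in> C"
      using that by (simp add: scaleR_diff_right)
  next
    assume "b *\<^sub>R y - x \<in> C"
    then have "inverse b *\<^sub>R (b *\<^sub>R y - x) \<in> C"
      using that by (intro scale_mem) auto
    then show "y - inverse b *\<^sub>R x \<in> C"
      using that by (simp add: scaleR_diff_right)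
  qed
  then have T: "thompson C x y = ln (Inf S)"
    unfolding thompson_def S_def
    by (intro arg_cong[where f = "\<lambda>A. ln (Inf A)"]) (auto simp: order_close_def cone_le_def)
  obtain b where "b \<in> S"
    using order_close_interior_ex[OF assms(1,2)] by (auto simp: S_def)
  then have ne: "S \<noteq> {}"
    by auto
  have bdd: "bdd_below S"
    by (rule bdd_belowI[of _ 1]) (auto simp: S_def)
  have "Inf S \<ge> 1"
    using ne by (intro cInf_greatest) (auto simp: S_def)
  then have "thompson C x y \<le> ln \<beta> \<longleftrightarrow> Inf S \<le> \<beta>"
    using assms by (simp add: T)
  also have "\<dots> \<longleftrightarrow> order_close C \<beta> x y"
  proof
    assume le: "Inf S \<le> \<beta>"
    have close: "order_close C (\<beta> + inverse (real (Suc n))) x y" for n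
    proof -
      have "Inf S < \<beta> + inverse (real (Suc n))"
        using le by (smt (verit) inverse_positive_iff_positive of_nat_0_less_iff zero_less_Suc)
      then obtain b where "b \<in> S" "b < \<beta> + inverse (real (Suc n))"
        using cInf_lessD[OF ne] by blast
      then show ?thesis
        by (auto simp: S_def xy intro: order_close_mono[of b])
    qed
    have "(\<lambda>n. (\<beta> + inverse (real (Suc n))) *\<^sub>R v - w) \<longlonglongrightarrow> (\<beta> + 0) *\<^sub>R v - w" for v w :: 'a
      by (intro tendsto_intros LIMSEQ_inverse_real_of_nat)
    then have limit_mem: "\<beta> *\<^sub>R v - w \<in> C"
      if "\<And>n. (\<beta> + inverse (real (Suc n))) *\<^sub>R v - w \<in> C" for v w
      using closed_sequentially[OF closed, of "\<lambda>n. (\<beta> + inverse (real (Suc n))) *\<^sub>R v - w"] that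
      by (metis add.right_neutral)
    have "\<beta> *\<^sub>R y - x \<in> C" "\<beta> *\<^sub>R x - y \<in> C"
      by (rule limit_mem, use close in \<open>simp add: order_close_def\<close>)+
    then show "order_close C \<beta> x y"
      by (simp add: order_close_def)
  next
    assume "order_close C \<beta> x y"
    then show "Inf S \<le> \<beta>"
      using assms by (intro cInf_lower bdd) (auto simp: S_def)
  qed
  finally show ?thesis .
qed

lemma order_close_nonexpansive:
  assumes "thompson_nonexpansive C f" "f ` interior C \<subseteq> interior C"
    and "x \<in> interior C" "y \<in> interior C" "\<beta> \<ge> 1" "order_close C \<beta> x y"
  shows "order_close C \<beta> (f x) (f y)"
proof -
  have "thompson C (f x) (f y) \<le> thompson C x y"
    using assms by (auto simp: thompson_nonexpansive_def)
  also have "\<dots> \<le> ln \<beta>"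
    using assms by (simp add: thompson_le_ln_iff)
  finally show ?thesis
    using assms by (subst (asm) thompson_le_ln_iff) auto
qed

section \<open>Norm estimates from normality\<close>

text \<open>Normality is applied to \<open>0 \<le> v + w \<le> 2 v\<close>; removing
  \<open>v\<close> again costs the summand 1 in the constant.\<close>

lemma normal_norm_bound:
  assumes "normal_cone C"
  obtains \<kappa> where "\<kappa> > 0" "\<And>w v. v - w \<in> C \<Longrightarrow> v + w \<in> C \<Longrightarrow> norm w \<le> \<kappa> * norm v"
proof -
  obtain k where k: "\<And>x y. x \<in> C \<Longrightarrow> y - x \<in> C \<Longrightarrow> norm x \<le> k * norm y"
    using assms by (auto simp: normal_cone_def cone_le_def)
  have "norm w \<le> (2 * \<bar>k\<bar> + 1) * norm v" if "v - w \<in> C" "v + w \<in> C" for v w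
  proof -
    have "norm (v + w) \<le> k * norm (2 *\<^sub>R v)"
      using that by (intro k) (auto simp: scaleR_2)
    also have "\<dots> \<le> \<bar>k\<bar> * norm (2 *\<^sub>R v)"
      by (intro mult_right_mono) auto
    finally have "norm (v + w) \<le> 2 * \<bar>k\<bar> * norm v"
      by simp
    moreover have "norm w \<le> norm (v + w) + norm v"
      by (metis add_diff_cancel_left' norm_triangle_ineq4)
    ultimately show ?thesis
      by (simp add: algebra_simps)
  qed
  then show thesis
    by (intro that[of "2 * \<bar>k\<bar> + 1"]) auto
qed

text \<open>Both \<open>a - b\<close> and \<open>b - a\<close> lie below
  \<open>(\<beta> - 1) B p\<close>. Thus order closeness controls the norm, uniformly over all
  points bounded by the same multiple of \<open>p\<close>.\<close>

lemma normal_dist_le_order_close: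
  assumes "normal_cone C" "B \<ge> 0"
  obtains L where "L > 0"
    "\<And>a b \<beta>. order_close C B a p \<Longrightarrow> order_close C B b p \<Longrightarrow> \<beta> \<ge> 1 \<Longrightarrow> order_close C \<beta> a b
       \<Longrightarrow> dist a b \<le> L * (\<beta> - 1)"
proof -
  obtain k where k: "k > 0" "\<And>w v. v - w \<in> C \<Longrightarrow> v + w \<in> C \<Longrightarrow> norm w \<le> k * norm v"
    using normal_norm_bound[OF assms(1)] by blast
  \<comment> \<open>The added 1 keeps the constant positive when \<open>B\<close> or
    \<open>p\<close> vanishes.\<close>
  have "dist a b \<le> (k * (B * norm p) + 1) * (\<beta> - 1)"
    if *: "order_close C B a p" "order_close C B b p" "\<beta> \<ge> 1" "order_close C \<beta> a b" for a b \<beta>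
  proof -
    let ?v = "((\<beta> - 1) * B) *\<^sub>R p"
    have "(\<beta> - 1) *\<^sub>R (B *\<^sub>R p - b) + (\<beta> *\<^sub>R b - a) \<in> C"
      "(\<beta> - 1) *\<^sub>R (B *\<^sub>R p - a) + (\<beta> *\<^sub>R a - b) \<in> C"
      using * by (auto simp: order_close_def intro!: add_mem scale_mem)
    then have "?v - (a - b) \<in> C" "?v + (a - b) \<in> C"
      by (simp_all add: algebra_simps)
    then have "norm (a - b) \<le> k * norm ?v"
      by (rule k)
    also have "\<dots> = k * (B * norm p) * (\<beta> - 1)"
      using * assms by simp
    also have "\<dots> \<le> (k * (B * norm p) + 1) * (\<beta> - 1)"
      using * by (intro mult_right_mono) auto
    finally show ?thesis
      by (simp add: dist_norm)
  qed
  moreover have "k * (B * norm p) + 1 > 0"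
    using k assms by (smt (verit) mult_nonneg_nonneg norm_ge_zero)
  ultimately show thesis
    using that by blast
qed

text \<open>Read backwards, the growth condition bounds each \<open>b j\<close> by a multiple of
  \<open>b N\<close>, at worst \<open>1 / r ^ N\<close>. A lower bound on a telescoping sum thereby
  becomes one on its last gap.\<close>

lemma weighted_sum_le_last:
  assumes mem: "\<And>j. j \<le> N \<Longrightarrow> b j \<in> C" and step: "\<And>j. j < N \<Longrightarrow> b (Suc j) - r *\<^sub>R b j \<in> C"
    and r: "0 < r" "r \<le> 1" and w: "\<And>j. j \<le> N \<Longrightarrow> 0 \<le> w j \<and> w j \<le> W"
  shows "(real (Suc N) * (W / r ^ N)) *\<^sub>R b N - (\<Sum>j\<le>N. w j *\<^sub>R b j) \<in> C"
proof -
  have geo: "b (j + i) - r ^ i *\<^sub>R b j \<in> C" if "j + i \<le> N" for i j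
    using that
  proof (induction i)
    case (Suc i)
    then have "(b (Suc (j + i)) - r *\<^sub>R b (j + i)) + r *\<^sub>R (b (j + i) - r ^ i *\<^sub>R b j) \<in> C"
      using r by (intro add_mem scale_mem step) auto
    then show ?case
      by (simp add: algebra_simps)
  qed (simp add: zero_mem)
  have "(W / r ^ N) *\<^sub>R b N - w j *\<^sub>R b j \<in> C" if j: "j \<le> N" for j
  proof -
    have W: "0 \<le> W"
      using w[OF j] by auto
    have "r ^ N \<le> r ^ (N - j)"
      using r by (intro power_decreasing) auto
    then have "w j * r ^ N \<le> W * r ^ (N - j)"
      using w[OF j] r W by (intro mult_mono) auto
    then have "w j \<le> W / r ^ N * r ^ (N - j)"
      using r by (simp add: field_simps)
    then have "(W / r ^ N) *\<^sub>R (b (j + (N - j)) - r ^ (N - j) *\<^sub>R b j)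
        + (W / r ^ N * r ^ (N - j) - w j) *\<^sub>R b j \<in> C"
      using j W r by (intro add_mem scale_mem geo mem) auto
    then show ?thesis
      using j by (simp add: algebra_simps)
  qed
  then have "(\<Sum>j\<le>N. (W / r ^ N) *\<^sub>R b N - w j *\<^sub>R b j) \<in> C"
    by (intro sum_mem) auto
  also have "(\<Sum>j\<le>N. (W / r ^ N) *\<^sub>R b N - w j *\<^sub>R b j)
      = (real (Suc N) * (W / r ^ N)) *\<^sub>R b N - (\<Sum>j\<le>N. w j *\<^sub>R b j)"
    by (simp only: sum_subtractf sum_constant_scaleR card_atMost scaleR_scaleR)
  finally show ?thesis .
qed

section \<open>Asymptotic regularity of averaged iterations\<close>

text \<open>The gaps of both one-sided inequalities are bounded below. The gain depends on
  \<open>B\<close>, \<open>N\<close> and \<open>\<alpha>\<close> but not on \<open>\<beta>\<close>,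
  so the improvement can be repeated with the same decrement.\<close>

lemma order_close_improvement:
  fixes x y :: "nat \<Rightarrow> 'a"
  assumes x: "\<And>n. x n \<in> C" and iter: "\<And>n. x (Suc n) = \<alpha> *\<^sub>R y n + (1 - \<alpha>) *\<^sub>R x n"
    and alpha: "0 < \<alpha>" "\<alpha> < 1"
    and bound: "\<And>m n. order_close C B (x m) (x n)" and beta: "1 \<le> \<beta>" "\<beta> \<le> B"
    and close_x: "\<And>n. order_close C \<beta> (x n) (x (Suc n))"
    and close_y: "\<And>n. order_close C \<beta> (y n) (y (Suc n))"
    and N: "B + 1 \<le> \<beta> ^ Suc N"
    and K: "K = real (Suc N) * (B ^ N / (1 - \<alpha>) ^ N)"
  shows "order_close C (\<beta> - 1 / (B * (B + 1) * K)) (x N) (x (Suc N))"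
proof -
  define i where "i = 1 / \<beta>"
  define b where "b j = \<beta> *\<^sub>R x j - x (Suc j)" for j
  define b' where "b' j = \<beta> *\<^sub>R x (Suc j) - x j" for j
  have Kpos: "K > 0"
    using beta alpha by (simp add: K)
  have B: "B \<ge> 1"
    using beta by simp
  have ib: "i * \<beta> = 1" "0 \<le> i" "i \<le> 1"
    using beta by (auto simp: i_def)
  \<comment> \<open>Powers of \<open>1 / \<beta>\<close> as weights leave \<open>x 0\<close> with
    coefficient 1; the opposite gaps below telescope with powers of \<open>\<beta>\<close>.\<close>
  have sum_b: "(\<Sum>j\<le>n. i ^ Suc j *\<^sub>R b j) = x 0 - i ^ Suc n *\<^sub>R x (Suc n)" for n
  proof (induction n)
    case 0
    then show ?case
      using ib by (simp add: b_def scaleR_diff_right)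
  next
    case (Suc n)
    have "i ^ Suc (Suc n) *\<^sub>R (\<beta> *\<^sub>R x (Suc n)) = i ^ Suc n *\<^sub>R x (Suc n)"
      using ib by (simp add: mult_ac)
    then show ?case
      unfolding sum.atMost_Suc Suc by (simp add: b_def scaleR_diff_right)
  qed
  have sum_b': "(\<Sum>j\<le>n. \<beta> ^ j *\<^sub>R b' j) = \<beta> ^ Suc n *\<^sub>R x (Suc n) - x 0" for n
    by (induction n) (simp_all add: b'_def scaleR_diff_right mult_ac)
  \<comment> \<open>Inserting the iteration rule into the later gap cancels the \<open>x\<close>
    terms and leaves \<open>\<alpha>\<close> times the corresponding gap of
    \<open>y\<close>.\<close>
  have step: "b (Suc j) - (1 - \<alpha>) *\<^sub>R b j \<in> C" "b' (Suc j) - (1 - \<alpha>) *\<^sub>R b' j \<in> C" for j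
  proof -
    have "b (Suc j) = \<beta> *\<^sub>R (\<alpha> *\<^sub>R y j + (1 - \<alpha>) *\<^sub>R x j) - (\<alpha> *\<^sub>R y (Suc j) + (1 - \<alpha>) *\<^sub>R x (Suc j))"
      unfolding b_def iter[symmetric] ..
    then have "b (Suc j) - (1 - \<alpha>) *\<^sub>R b j = \<alpha> *\<^sub>R (\<beta> *\<^sub>R y j - y (Suc j))"
      by (simp add: b_def algebra_simps)
    moreover have "b' (Suc j) = \<beta> *\<^sub>R (\<alpha> *\<^sub>R y (Suc j) + (1 - \<alpha>) *\<^sub>R x (Suc j)) - (\<alpha> *\<^sub>R y j + (1 - \<alpha>) *\<^sub>R x j)"
      unfolding b'_def iter[symmetric] ..
    then have "b' (Suc j) - (1 - \<alpha>) *\<^sub>R b' j = \<alpha> *\<^sub>R (\<beta> *\<^sub>R y (Suc j) - y j)"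
      by (simp add: b'_def algebra_simps)
    ultimately show "b (Suc j) - (1 - \<alpha>) *\<^sub>R b j \<in> C" "b' (Suc j) - (1 - \<alpha>) *\<^sub>R b' j \<in> C"
      using close_y[of j] alpha by (auto simp: order_close_def intro!: scale_mem)
  qed
  have mem: "b j \<in> C" "b' j \<in> C" for j
    using close_x[of j] by (auto simp: b_def b'_def order_close_def)
  have weights: "0 \<le> i ^ Suc j \<and> i ^ Suc j \<le> B ^ N" "0 \<le> \<beta> ^ j \<and> \<beta> ^ j \<le> B ^ N" if "j \<le> N" for j
  proof -
    have "i ^ Suc j \<le> 1"
      using ib by (intro power_le_one) auto
    also have "1 \<le> B ^ N"
      using B by simp
    finally show "0 \<le> i ^ Suc j \<and> i ^ Suc j \<le> B ^ N"
      using ib by simp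
    have "\<beta> ^ j \<le> \<beta> ^ N"
      using that beta by (intro power_increasing) auto
    also have "\<dots> \<le> B ^ N"
      using beta by (intro power_mono) auto
    finally show "0 \<le> \<beta> ^ j \<and> \<beta> ^ j \<le> B ^ N"
      using beta by simp
  qed
  have le_b: "K *\<^sub>R b N - (x 0 - i ^ Suc N *\<^sub>R x (Suc N)) \<in> C"
    unfolding sum_b[symmetric] K
    by (intro weighted_sum_le_last mem step weights) (use alpha in auto)
  have le_b': "K *\<^sub>R b' N - (\<beta> ^ Suc N *\<^sub>R x (Suc N) - x 0) \<in> C"
    unfolding sum_b'[symmetric] K
    by (intro weighted_sum_le_last mem step weights) (use alpha in auto)
  \<comment> \<open>The three factors come from the chain \<open>K b N \<ge> x 0 - i ^ Suc N x (Suc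
    N) \<ge> x 0 / (B + 1) \<ge> x N / (B (B + 1))\<close>.\<close>
  define c where "c = 1 / (B * (B + 1) * K)"
  have "i ^ Suc N * (B + 1) \<le> i ^ Suc N * \<beta> ^ Suc N"
    using N ib by (intro mult_left_mono) auto
  also have "\<dots> = 1"
    using ib by (metis power_mult_distrib power_one)
  finally have iN: "i ^ Suc N * (B + 1) \<le> 1" .
  then have "i ^ Suc N \<le> 1 / (B + 1)"
    using B by (simp add: field_simps)
  then have "B * i ^ Suc N \<le> B * (1 / (B + 1))"
    using B by (intro mult_left_mono) auto
  also have "\<dots> = 1 - 1 / (B + 1)"
    using B by (simp add: field_simps)
  finally have iN': "0 \<le> 1 - 1 / (B + 1) - B * i ^ Suc N"
    by simp
  have "i ^ Suc N *\<^sub>R (B *\<^sub>R x 0 - x (Suc N)) + (1 - 1 / (B + 1) - B * i ^ Suc N) *\<^sub>R x 0 \<in> C"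
    using iN' ib x bound[of 0 "Suc N"] by (intro add_mem scale_mem) (auto simp: order_close_def)
  then have "(x 0 - i ^ Suc N *\<^sub>R x (Suc N)) - (1 / (B + 1)) *\<^sub>R x 0 \<in> C"
    by (simp add: algebra_simps)
  from add_mem[OF le_b this] have "K *\<^sub>R b N - (1 / (B + 1)) *\<^sub>R x 0 \<in> C"
    by (simp add: algebra_simps)
  moreover have "(1 / (B * (B + 1))) *\<^sub>R (B *\<^sub>R x 0 - x N) \<in> C"
    using B bound[of 0 N] by (intro scale_mem) (auto simp: order_close_def)
  then have "(1 / (B + 1)) *\<^sub>R x 0 - (1 / (B * (B + 1))) *\<^sub>R x N \<in> C"
    using B by (simp add: scaleR_diff_right)
  ultimately have "(K *\<^sub>R b N - (1 / (B + 1)) *\<^sub>R x 0) +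
      ((1 / (B + 1)) *\<^sub>R x 0 - (1 / (B * (B + 1))) *\<^sub>R x N) \<in> C"
    by (rule add_mem)
  then have "(1 / K) *\<^sub>R (K *\<^sub>R b N - (1 / (B * (B + 1))) *\<^sub>R x N) \<in> C"
    using Kpos by (intro scale_mem) auto
  then have "b N - c *\<^sub>R x N \<in> C"
    using Kpos by (simp add: c_def scaleR_diff_right mult_ac)
  then have 1: "(\<beta> - c) *\<^sub>R x N - x (Suc N) \<in> C"
    by (simp add: b_def algebra_simps)
  \<comment> \<open>Since \<open>x 0 \<le> B x (Suc N)\<close> and
    \<open>\<beta> ^ Suc N \<ge> B + 1\<close>, a full copy of \<open>x (Suc N)\<close> remains; the
    gain \<open>1 / K\<close> is at least \<open>c\<close>.\<close>
  have "(K *\<^sub>R b' N - (\<beta> ^ Suc N *\<^sub>R x (Suc N) - x 0)) + (B *\<^sub>R x (Suc N) - x 0)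
      + (\<beta> ^ Suc N - (B + 1)) *\<^sub>R x (Suc N) \<in> C"
    using N x le_b' bound[of 0 "Suc N"] by (intro add_mem scale_mem) (auto simp: order_close_def)
  then have "K *\<^sub>R b' N - x (Suc N) \<in> C"
    by (simp add: algebra_simps)
  then have "(1 / K) *\<^sub>R (K *\<^sub>R b' N - x (Suc N)) + (1 / K - c) *\<^sub>R x (Suc N) \<in> C"
  proof (intro add_mem scale_mem x)
    have "1 * 1 \<le> B * (B + 1)"
      using B by (intro mult_mono) auto
    then have "1 * K \<le> B * (B + 1) * K"
      using Kpos by (intro mult_right_mono) auto
    then show "0 \<le> 1 / K - c"
      using Kpos by (simp add: c_def frac_le)
  qed (use Kpos in auto)
  then have "b' N - c *\<^sub>R x (Suc N) \<in> C"
    using Kpos by (simp add: scaleR_diff_right scaleR_diff_left)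
  then have 2: "(\<beta> - c) *\<^sub>R x (Suc N) - x N \<in> C"
    by (simp add: b'_def algebra_simps)
  from 1 2 show ?thesis
    by (simp add: order_close_def c_def)
qed

text \<open>If no step were \<open>\<beta>\<close>-close, the factor could be lowered from
  \<open>B\<close> by the same \<open>c\<close> indefinitely. One close step suffices, since
  averaging a nonexpansive map preserves closeness of consecutive iterates.\<close>

lemma averaged_asymptotically_regular:
  fixes x y :: "nat \<Rightarrow> 'a"
  assumes x: "\<And>n. x n \<in> C" and iter: "\<And>n. x (Suc n) = \<alpha> *\<^sub>R y n + (1 - \<alpha>) *\<^sub>R x n"
    and alpha: "0 < \<alpha>" "\<alpha> < 1"
    and bound: "\<And>m n. order_close C B (x m) (x n)"
    and y: "\<And>m n \<beta>. 1 \<le> \<beta> \<Longrightarrow> order_close C \<beta> (x m) (x n) \<Longrightarrow> order_close C \<beta> (y m) (y n)"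
    and beta: "1 < \<beta>" "\<beta> \<le> B"
  shows "\<exists>m. \<forall>n\<ge>m. order_close C \<beta> (x n) (x (Suc n))"
proof -
  have persist: "order_close C b (x n) (x (Suc n))"
    if "1 \<le> b" "order_close C b (x m) (x (Suc m))" "m \<le> n" for b m n
    using that(3)
  proof (induction n rule: dec_induct)
    case (step n)
    then show ?case
      using order_close_convex_comb[OF y[OF that(1)], of n "Suc n" "x n" "x (Suc n)" \<alpha>] alpha
      by (simp add: iter)
  qed (fact that(2))
  \<comment> \<open>Chosen for the target \<open>\<beta>\<close>, this \<open>N\<close> serves every
    intermediate factor \<open>b \<ge> \<beta>\<close>, which keeps \<open>c\<close> fixed through
    all rounds.\<close>
  obtain N where N: "B + 1 < \<beta> ^ N"
    using real_arch_pow beta by blast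
  have N': "B + 1 \<le> b ^ Suc N" if "\<beta> \<le> b" for b
  proof -
    have "\<beta> ^ N \<le> b ^ N"
      using that beta by (intro power_mono) auto
    also have "\<dots> \<le> b ^ Suc N"
      using that beta by (intro power_increasing) auto
    finally show ?thesis
      using N by simp
  qed
  define K where "K = real (Suc N) * (B ^ N / (1 - \<alpha>) ^ N)"
  define c where "c = 1 / (B * (B + 1) * K)"
  have c: "c > 0"
    using beta alpha by (simp add: c_def K_def)
  have "\<exists>m. order_close C \<beta> (x m) (x (Suc m))"
  proof (rule ccontr)
    assume none: "\<not> (\<exists>m. order_close C \<beta> (x m) (x (Suc m)))"
    have "\<exists>m. order_close C (B - real k * c) (x m) (x (Suc m))" for k
    proof (induction k)
      case 0
      then show ?case
        using bound by auto
    next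
      case (Suc k)
      then obtain m where m: "order_close C (B - real k * c) (x m) (x (Suc m))"
        by blast
      define b where "b = B - real k * c"
      have "\<beta> \<le> b"
        using m none order_close_mono[of b] x by (metis b_def linear)
      moreover have "b \<le> B"
        using c by (simp add: b_def)
      moreover have cl: "order_close C b (x (m + n)) (x (m + Suc n))" for n
        using m \<open>\<beta> \<le> b\<close> beta persist[of b m "m + n"] by (auto simp: b_def)
      moreover have "order_close C b (y (m + n)) (y (m + Suc n))" for n
        using \<open>\<beta> \<le> b\<close> beta by (intro y cl) auto
      moreover have "x (m + Suc n) = \<alpha> *\<^sub>R y (m + n) + (1 - \<alpha>) *\<^sub>R x (m + n)" for n
        using iter[of "m + n"] by simp
      \<comment> \<open>The improvement is applied to the orbit restarted at time
        \<open>m\<close>.\<close>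
      ultimately have "order_close C (b - 1 / (B * (B + 1) * K)) (x (m + N)) (x (m + Suc N))"
        using beta
        by (intro order_close_improvement[where x = "\<lambda>n. x (m + n)" and y = "\<lambda>n. y (m + n)",
              OF x _ alpha bound _ _ _ _ N' K_def]) auto
      then have "order_close C (B - real (Suc k) * c) (x (m + N)) (x (Suc (m + N)))"
        by (simp add: b_def flip: c_def) (simp add: algebra_simps)
      then show ?case
        by blast
    qed
    moreover obtain k where "B < real k * c"
      using reals_Archimedean3[OF c] by blast
    ultimately obtain m where m: "order_close C (B - real k * c) (x m) (x (Suc m))"
      by blast
    have "order_close C \<beta> (x m) (x (Suc m))"
      using \<open>B < real k * c\<close> beta by (intro order_close_mono[OF m] x) auto
    then show False
      using none by blast
  qed
  then show ?thesis
    using persist beta by (metis less_imp_le)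
qed

end

section \<open>Kuratowski measures of noncompactness\<close>

text \<open>The distance is a parameter so that one argument covers both the norm and Thompson's
  metric.\<close>

definition finite_cover_le :: "('a \<Rightarrow> 'a \<Rightarrow> real) \<Rightarrow> real \<Rightarrow> 'a set \<Rightarrow> bool" where
  "finite_cover_le D d A \<longleftrightarrow>
     (\<exists>F. finite F \<and> A \<subseteq> \<Union>F \<and> (\<forall>S\<in>F. \<forall>a\<in>S. \<forall>b\<in>S. D a b \<le> d))"

definition kuratowski :: "('a \<Rightarrow> 'a \<Rightarrow> real) \<Rightarrow> 'a set \<Rightarrow> ereal" where
  "kuratowski D A = Inf {ereal d | d. d > 0 \<and> finite_cover_le D d A}"

lemma kur_gamma_eq_kuratowski: "kur_gamma A = kuratowski dist A"
proof -
  have "norm_diam S \<le> ereal d \<longleftrightarrow> (\<forall>a\<in>S. \<forall>b\<in>S. dist a b \<le> d)" for S :: "'a set" and d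
    by (auto simp: norm_diam_def SUP_le_iff)
  then show ?thesis
    by (simp add: kur_gamma_def kuratowski_def finite_cover_le_def)
qed

text \<open>Intersecting the members of a cover with the interior still covers \<open>A\<close> and
  enlarges no diameter.\<close>

lemma kur_tau_eq_kuratowski:
  assumes "A \<subseteq> interior C"
  shows "kur_tau C A = kuratowski (thompson C) A"
proof -
  have diam: "thompson_diam C S \<le> ereal d \<longleftrightarrow> (\<forall>a\<in>S. \<forall>b\<in>S. thompson C a b \<le> d)" for S d
    by (auto simp: thompson_diam_def SUP_le_iff)
  have "(\<exists>F. finite F \<and> A \<subseteq> \<Union>F \<and> (\<forall>S\<in>F. S \<subseteq> interior C \<and> thompson_diam C S \<le> ereal d))
      \<longleftrightarrow> finite_cover_le (thompson C) d A" for d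
  proof
    assume "finite_cover_le (thompson C) d A"
    then obtain F where F: "finite F" "A \<subseteq> \<Union>F" "\<forall>S\<in>F. \<forall>a\<in>S. \<forall>b\<in>S. thompson C a b \<le> d"
      unfolding finite_cover_le_def by blast
    have "finite ((\<lambda>S. S \<inter> interior C) ` F)" "A \<subseteq> \<Union>((\<lambda>S. S \<inter> interior C) ` F)"
      using F assms by auto
    moreover have "\<forall>S\<in>(\<lambda>S. S \<inter> interior C) ` F. S \<subseteq> interior C \<and> thompson_diam C S \<le> ereal d"
      using F(3) unfolding diam by auto
    ultimately show "\<exists>F. finite F \<and> A \<subseteq> \<Union>F \<and>
        (\<forall>S\<in>F. S \<subseteq> interior C \<and> thompson_diam C S \<le> ereal d)"
      by blast
  qed (auto simp: finite_cover_le_def diam)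
  then show ?thesis
    by (simp add: kur_tau_def kuratowski_def)
qed

lemma finite_cover_le_mono:
  assumes "finite_cover_le D d A" "d \<le> d'"
  shows "finite_cover_le D d' A"
proof -
  obtain F where "finite F" "A \<subseteq> \<Union>F" "\<forall>S\<in>F. \<forall>a\<in>S. \<forall>b\<in>S. D a b \<le> d"
    using assms(1) unfolding finite_cover_le_def by blast
  then show ?thesis
    unfolding finite_cover_le_def using assms(2)
    by (intro exI[of _ F] conjI ballI order_trans[OF _ assms(2)]) auto
qed

text \<open>Points are classified by a piece containing their \<open>f\<close>-image together with a
  piece containing the point. The \<open>g\<close>-images of these finitely many classes, with
  \<open>{x0}\<close> added, cover \<open>A\<close>.\<close>

lemma finite_cover_le_average:
  assumes "finite_cover_le D s (f ` A)" "finite_cover_le D t A"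
    and inv: "A \<subseteq> insert x0 (g ` A)" and x0: "D x0 x0 \<le> u"
    and avg: "\<And>a b. a \<in> A \<Longrightarrow> b \<in> A \<Longrightarrow> D (f a) (f b) \<le> s \<Longrightarrow> D a b \<le> t \<Longrightarrow> D (g a) (g b) \<le> u"
  shows "finite_cover_le D u A"
proof -
  obtain F where F: "finite F" "f ` A \<subseteq> \<Union>F" "\<forall>S\<in>F. \<forall>a\<in>S. \<forall>b\<in>S. D a b \<le> s"
    using assms(1) unfolding finite_cover_le_def by blast
  obtain G where G: "finite G" "A \<subseteq> \<Union>G" "\<forall>S\<in>G. \<forall>a\<in>S. \<forall>b\<in>S. D a b \<le> t"
    using assms(2) unfolding finite_cover_le_def by blast
  define H where "H = insert {x0} ((\<lambda>(S, T). g ` {a \<in> A. f a \<in> S \<and> a \<in> T}) ` (F \<times> G))"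
  have "finite H"
    using F G by (simp add: H_def)
  moreover have "A \<subseteq> \<Union>H"
  proof
    fix z assume "z \<in> A"
    then consider "z = x0" | a where "a \<in> A" "z = g a"
      using inv by blast
    then show "z \<in> \<Union>H"
    proof cases
      case 2
      then obtain S T where "S \<in> F" "f a \<in> S" "T \<in> G" "a \<in> T"
        using F(2) G(2) by blast
      with 2 show ?thesis
        by (auto simp: H_def intro!: bexI[of _ "(S, T)"])
    qed (simp add: H_def)
  qed
  moreover have "\<forall>S\<in>H. \<forall>a\<in>S. \<forall>b\<in>S. D a b \<le> u"
    using x0 F(3) G(3) by (auto simp: H_def intro!: avg)
  ultimately show ?thesis
    unfolding finite_cover_le_def by blast
qed

text \<open>A positive measure \<open>t\<close> is contradicted by a cover of size
  \<open>u < t\<close>. As the infimum \<open>t\<close> may not be attained, \<open>avg\<close> must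
  tolerate a cover of some size \<open>t' > t\<close>.\<close>

lemma kuratowski_condensing_average:
  assumes fin: "finite_cover_le D d A"
    and inv: "A \<subseteq> insert x0 (g ` A)" and x0: "D x0 x0 \<le> 0"
    and cond: "kuratowski D A > 0 \<Longrightarrow> kuratowski D (f ` A) < kuratowski D A"
    and avg: "\<And>s t. 0 < s \<Longrightarrow> s < t \<Longrightarrow> \<exists>u t'. 0 < u \<and> u < t \<and> t < t' \<and>
      (\<forall>a\<in>A. \<forall>b\<in>A. D (f a) (f b) \<le> s \<longrightarrow> D a b \<le> t' \<longrightarrow> D (g a) (g b) \<le> u)"
    and e: "e > 0"
  shows "finite_cover_le D e A"
proof -
  have ex_cover: "\<exists>s>0. ereal s < r \<and> finite_cover_le D s B" if "kuratowski D B < r" for B r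
    using that unfolding kuratowski_def Inf_less_iff by auto
  have kur_le: "kuratowski D B \<le> ereal s" if "finite_cover_le D s B" "s > 0" for B s
    using that unfolding kuratowski_def by (intro Inf_lower) auto
  have "kuratowski D A \<le> 0"
  proof (rule ccontr)
    assume "\<not> kuratowski D A \<le> 0"
    then have pos: "kuratowski D A > 0"
      by simp
    \<comment> \<open>The given cover makes the measure finite; \<open>max d 1\<close> is used since
      only positive sizes enter the infimum.\<close>
    obtain m where "kuratowski D A \<le> ereal m"
    proof
      show "kuratowski D A \<le> ereal (max d 1)"
        using fin by (intro kur_le finite_cover_le_mono[OF fin]) auto
    qed
    with pos obtain t where t: "kuratowski D A = ereal t"
      by (cases "kuratowski D A") auto
    obtain s where s: "s > 0" "s < t" "finite_cover_le D s (f ` A)"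
      using ex_cover[OF cond[OF pos]] t by auto
    obtain u t' where u: "0 < u" "u < t" "t < t'"
      "\<And>a b. a \<in> A \<Longrightarrow> b \<in> A \<Longrightarrow> D (f a) (f b) \<le> s \<Longrightarrow> D a b \<le> t' \<Longrightarrow> D (g a) (g b) \<le> u"
      using avg[OF s(1,2)] by blast
    obtain t'' where "ereal t'' < ereal t'" "finite_cover_le D t'' A"
      using ex_cover[of A "ereal t'"] t u by auto
    then have "finite_cover_le D t' A"
      by (auto intro: finite_cover_le_mono)
    from finite_cover_le_average[OF s(3) this inv _ u(4)] have "finite_cover_le D u A"
      using x0 u(1) by simp
    from kur_le[OF this u(1)] have "t \<le> u"
      by (simp add: t)
    with u show False
      by simp
  qed
  then have "kuratowski D A < ereal e"
    using e by (simp add: le_less_trans)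
  then show ?thesis
    by (auto dest!: ex_cover intro: finite_cover_le_mono)
qed

text \<open>Small pieces become balls around chosen points, which gives total boundedness; closed
  balls of half the radius also cover the closure.\<close>

lemma compact_closure_finite_cover_le:
  fixes A :: "'a::complete_space set"
  assumes "\<And>e. e > 0 \<Longrightarrow> finite_cover_le dist e A"
  shows "compact (closure A)"
proof -
  have "\<exists>k. finite k \<and> closure A \<subseteq> (\<Union>c\<in>k. ball c e)" if "e > 0" for e
  proof -
    obtain F where F: "finite F" "A \<subseteq> \<Union>F" "\<And>S a b. S \<in> F \<Longrightarrow> a \<in> S \<Longrightarrow> b \<in> S \<Longrightarrow> dist a b \<le> e / 2"
      using assms[of "e / 2"] \<open>e > 0\<close> unfolding finite_cover_le_def by (metis half_gt_zero)
    let ?c = "\<lambda>S. SOME a. a \<in> S"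
    have "A \<subseteq> (\<Union>c\<in>?c ` F. cball c (e / 2))"
    proof
      fix a assume "a \<in> A"
      then obtain S where "S \<in> F" "a \<in> S"
        using F by blast
      moreover from this have "?c S \<in> S"
        by (auto intro: someI)
      ultimately show "a \<in> (\<Union>c\<in>?c ` F. cball c (e / 2))"
        using F(3) by force
    qed
    then have "closure A \<subseteq> (\<Union>c\<in>?c ` F. cball c (e / 2))"
      using F by (intro closure_minimal closed_UN) auto
    also have "\<dots> \<subseteq> (\<Union>c\<in>?c ` F. ball c e)"
      using \<open>e > 0\<close> by (intro UN_mono) auto
    finally show ?thesis
      using F by blast
  qed
  then show ?thesis
    by (simp add: compact_eq_totally_bounded complete_eq_closed)
qed

section \<open>Convergence of the averaged iteration\<close>

theorem theorem3p1:
  fixes C :: "'a::banach set" and f :: "'a \<Rightarrow> 'a" and \<alpha> :: real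
    and x :: "nat \<Rightarrow> 'a"
  assumes cone: "closed_cone C" and normal: "normal_cone C"
    and int_ne: "interior C \<noteq> {}"
    and f_maps: "f ` interior C \<subseteq> interior C"
    and nonexp: "thompson_nonexpansive C f"
    and cond: "gamma_condensing C f \<or> tau_condensing C f"
    and fixp: "\<exists>p\<in>interior C. f p = p"
    and alpha: "0 < \<alpha>" "\<alpha> < 1"
    and x0: "x 0 \<in> interior C"
    and iter: "\<And>n. x (Suc n) = \<alpha> *\<^sub>R f (x n) + (1 - \<alpha>) *\<^sub>R x n"
  shows "\<exists>p\<in>interior C. f p = p \<and> x \<longlonglongrightarrow> p"
proof -
  interpret cone_order C
    by standard (fact cone)
  have intC: "a \<in> C" if "a \<in> interior C" for a
    using that interior_subset by auto
  have f_int: "f a \<in> interior C" if "a \<in> interior C" for a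
    using that f_maps by auto
  have x_int: "x n \<in> interior C" for n
    by (induction n) (auto simp: x0 iter alpha f_int intro!: interior_convex_comb)
  define g where "g a = \<alpha> *\<^sub>R f a + (1 - \<alpha>) *\<^sub>R a" for a
  have g_x: "g (x n) = x (Suc n)" for n
    by (simp add: g_def iter)
  have close_f: "order_close C \<beta> (f a) (f b)"
    if "a \<in> interior C" "b \<in> interior C" "1 \<le> \<beta>" "order_close C \<beta> a b" for a b \<beta>
    using order_close_nonexpansive[OF nonexp f_maps that] .
  \<comment> \<open>A fixed point of \<open>f\<close> is fixed by the averaging too. This serves
    twice: for boundedness around \<open>p\<close> and for convergence to \<open>q\<close>.\<close>
  have toward_fixed: "order_close C \<beta> (x n) q"
    if "q \<in> interior C" "f q = q" "1 \<le> \<beta>" "order_close C \<beta> (x m) q" "m \<le> n" for \<beta> m n q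
    using that(5)
  proof (induction n rule: dec_induct)
    case (step n)
    then show ?case
      using order_close_convex_comb[OF close_f[OF x_int that(1,3) step.IH] step.IH, of \<alpha>] that alpha
      by (simp add: iter flip: scaleR_add_left)
  qed (fact that(4))
  obtain p where p: "p \<in> interior C" "f p = p"
    using fixp by blast
  obtain R where R: "R \<ge> 1" "order_close C R (x 0) p"
    using order_close_interior_ex[OF x0 p(1)] by blast
  have x_p: "order_close C R (x n) p" for n
    using toward_fixed[OF p R] by simp
  have fx_p: "order_close C R (f (x n)) p" for n
    using close_f[OF x_int p(1) R(1) x_p] p by simp
  \<comment> \<open>Any two points that are \<open>R\<close>-close to \<open>p\<close>, such as
    iterates and their \<open>f\<close>-images, are \<open>R * R\<close>-close to each
    other.\<close>
  define B where "B = R * R"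
  have B: "B \<ge> 1"
    using R mult_mono[of 1 R 1 R] by (simp add: B_def)
  have near: "order_close C B a b" if "order_close C R a p" "order_close C R b p" for a b
    unfolding B_def using that R by (intro order_close_trans[of _ _ p]) (auto simp: order_close_commute)
  obtain L where L: "L > 0"
    "\<And>a b \<beta>. order_close C R a p \<Longrightarrow> order_close C R b p \<Longrightarrow> \<beta> \<ge> 1 \<Longrightarrow> order_close C \<beta> a b
       \<Longrightarrow> dist a b \<le> L * (\<beta> - 1)"
    using normal_dist_le_order_close[OF normal, of R p] R by auto
  define A where "A = range x"
  have A_int: "A \<subseteq> interior C"
    using x_int by (auto simp: A_def)
  have inv: "A \<subseteq> insert (x 0) (g ` A)"
  proof
    fix a assume "a \<in> A"
    then obtain n where "a = x n"
      by (auto simp: A_def)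
    then show "a \<in> insert (x 0) (g ` A)"
      by (cases n) (auto simp: A_def g_x[symmetric])
  qed
  have dist_A: "dist a b \<le> L * (B - 1)" if "a \<in> A" "b \<in> A" for a b
    using that by (auto simp: A_def intro!: L near x_p B)
  have f_cont: "continuous_on (interior C) f"
    using cond by (auto simp: gamma_condensing_def tau_condensing_def)
  have precompact: "finite_cover_le dist e A" if "e > 0" for e
    using cond
  proof
    assume gc: "gamma_condensing C f"
    show ?thesis
    proof (rule kuratowski_condensing_average[where f = f, OF _ inv _ _ _ \<open>e > 0\<close>])
      show "finite_cover_le dist (L * (B - 1)) A"
        unfolding finite_cover_le_def using dist_A by (intro exI[of _ "{A}"]) auto
      have "bounded A"
        using dist_A by (auto simp: bounded_two_points)
      then show "kuratowski dist (f ` A) < kuratowski dist A" if "kuratowski dist A > 0"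
        using gc that A_int by (simp add: gamma_condensing_def kur_gamma_eq_kuratowski)
      fix s t :: real
      assume st: "0 < s" "s < t"
      \<comment> \<open>The smaller \<open>f\<close>-part saves
        \<open>\<alpha> (t - s) = 2 h\<close>, while enlarging \<open>t\<close> to
        \<open>t + h\<close> costs only \<open>(1 - \<alpha>) h\<close>.\<close>
      define h where "h = \<alpha> * (t - s) / 2"
      have h: "h > 0"
        using st alpha by (simp add: h_def)
      define u where "u = \<alpha> * s + (1 - \<alpha>) * (t + h)"
      have "(1 - \<alpha>) * h \<le> 1 * h"
        using h alpha by (intro mult_right_mono) auto
      moreover have "u = t - 2 * h + (1 - \<alpha>) * h"
        by (simp add: u_def h_def field_simps)
      ultimately have "u < t"
        using h by simp
      moreover have "u > 0"
        using st h alpha by (simp add: u_def add_pos_pos)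
      moreover have "dist (g a) (g b) \<le> u" if "dist (f a) (f b) \<le> s" "dist a b \<le> t + h" for a b
      proof -
        have "g a - g b = \<alpha> *\<^sub>R (f a - f b) + (1 - \<alpha>) *\<^sub>R (a - b)"
          by (simp add: g_def algebra_simps)
        then have "dist (g a) (g b) \<le> norm (\<alpha> *\<^sub>R (f a - f b)) + norm ((1 - \<alpha>) *\<^sub>R (a - b))"
          by (simp add: dist_norm norm_triangle_ineq del: norm_scaleR)
        also have "\<dots> = \<alpha> * dist (f a) (f b) + (1 - \<alpha>) * dist a b"
          using alpha by (simp add: dist_norm)
        also have "\<dots> \<le> u"
          unfolding u_def using that alpha by (intro add_mono mult_left_mono) auto
        finally show ?thesis .
      qed
      ultimately show "\<exists>u t'. 0 < u \<and> u < t \<and> t < t' \<and> (\<forall>a\<in>A. \<forall>b\<in>A.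
          dist (f a) (f b) \<le> s \<longrightarrow> dist a b \<le> t' \<longrightarrow> dist (g a) (g b) \<le> u)"
        using h by (intro exI[of _ u] exI[of _ "t + h"]) auto
    qed simp
  next
    assume tc: "tau_condensing C f"
    have thompson_A: "thompson C a b \<le> ln B" if "a \<in> A" "b \<in> A" for a b
      using that A_int B by (subst thompson_le_ln_iff) (auto simp: A_def intro!: near x_p)
    have fA_int: "f ` A \<subseteq> interior C"
      using A_int f_int by auto
    have g_int: "g a \<in> interior C" if "a \<in> interior C" for a
      unfolding g_def using that f_int alpha by (intro interior_convex_comb)
    have cover: "finite_cover_le (thompson C) e' A" if "e' > 0" for e'
    proof (rule kuratowski_condensing_average[where f = f, OF _ inv _ _ _ that])
      show "finite_cover_le (thompson C) (ln B) A"
        unfolding finite_cover_le_def using thompson_A by (intro exI[of _ "{A}"]) auto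
      show "thompson C (x 0) (x 0) \<le> 0"
        using thompson_le_ln_iff[OF x0 x0, of 1] by (simp add: order_close_def zero_mem)
      have "thompson_bounded C A"
        using A_int thompson_A by (auto simp: thompson_bounded_def)
      then show "kuratowski (thompson C) (f ` A) < kuratowski (thompson C) A"
        if "kuratowski (thompson C) A > 0"
        using tc that unfolding tau_condensing_def
        by (metis kur_tau_eq_kuratowski[OF A_int] kur_tau_eq_kuratowski[OF fA_int])
      fix s t :: real
      assume st: "0 < s" "s < t"
      \<comment> \<open>\<open>h\<close> solves \<open>\<alpha> (U - exp s) = (1 - \<alpha>) (T - U) B\<close> for \<open>U = exp t - h\<close> and \<open>T = exp t + h\<close>.\<close>
      define h where "h = \<alpha> * (exp t - exp s) / (2 * (1 - \<alpha>) * B + \<alpha>)"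
      have den: "2 * (1 - \<alpha>) * B + \<alpha> > 0"
        using alpha B by (simp add: add_nonneg_pos)
      then have h: "h > 0"
        using st alpha by (simp add: h_def)
      define U where "U = exp t - h"
      define T where "T = exp t + h"
      have "h * (2 * (1 - \<alpha>) * B + \<alpha>) = \<alpha> * (exp t - exp s)"
        unfolding h_def using den by simp
      then have key: "\<alpha> * (U - exp s) = (1 - \<alpha>) * (T - U) * B"
        by (simp add: U_def T_def algebra_simps)
      have "(1 - \<alpha>) * (T - U) * B > 0"
        using h alpha B by (simp add: U_def T_def)
      then have US: "U > exp s"
        using alpha by (simp flip: key add: zero_less_mult_iff)
      moreover have "exp s > 1"
        using st by simp
      ultimately have U1: "U > 1"
        by (rule less_trans[rotated])
      have T1: "T > exp t"
        using h by (simp add: T_def)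
      have "thompson C (g a) (g b) \<le> ln U"
        if ab: "a \<in> A" "b \<in> A" and "thompson C (f a) (f b) \<le> s" "thompson C a b \<le> ln T" for a b
      proof -
        \<comment> \<open>The \<open>f\<close>-part has slack below \<open>U\<close>, the other part
          exceeds it by \<open>T - U\<close>. The bound \<open>b \<le> B f b\<close> moves this
          excess into the \<open>f b\<close> term, where \<open>key\<close> makes it fit
          exactly.\<close>
        have half: "U *\<^sub>R g b - g a \<in> C"
          if "exp s *\<^sub>R f b - f a \<in> C" "T *\<^sub>R b - a \<in> C" "B *\<^sub>R f b - b \<in> C" for a b
        proof -
          have "\<alpha> *\<^sub>R (exp s *\<^sub>R f b - f a) + (1 - \<alpha>) *\<^sub>R (T *\<^sub>R b - a)
              + ((1 - \<alpha>) * (T - U)) *\<^sub>R (B *\<^sub>R f b - b) \<in> C"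
            using that alpha h by (intro add_mem scale_mem) (auto simp: U_def T_def)
          also have "\<alpha> *\<^sub>R (exp s *\<^sub>R f b - f a) + (1 - \<alpha>) *\<^sub>R (T *\<^sub>R b - a)
              + ((1 - \<alpha>) * (T - U)) *\<^sub>R (B *\<^sub>R f b - b)
            = (\<alpha> * exp s + (1 - \<alpha>) * (T - U) * B) *\<^sub>R f b + ((1 - \<alpha>) * U) *\<^sub>R b - g a"
            by (simp add: g_def algebra_simps)
          also have "\<alpha> * exp s + (1 - \<alpha>) * (T - U) * B = \<alpha> * U"
            unfolding key[symmetric] by (simp add: algebra_simps)
          also have "(\<alpha> * U) *\<^sub>R f b + ((1 - \<alpha>) * U) *\<^sub>R b - g a = U *\<^sub>R g b - g a"
            by (simp add: g_def algebra_simps)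
          finally show ?thesis .
        qed
        have "order_close C (exp s) (f a) (f b)"
          using that A_int f_int st by (subst thompson_le_ln_iff[symmetric]) auto
        moreover have "order_close C T a b"
          using that A_int U1 h by (subst thompson_le_ln_iff[symmetric]) (auto simp: U_def T_def)
        moreover have "order_close C B a (f a)" "order_close C B b (f b)"
          using ab by (auto simp: A_def intro!: near x_p fx_p)
        ultimately have "order_close C U (g a) (g b)"
          by (auto simp: order_close_def intro!: half)
        then show ?thesis
          using ab A_int g_int U1 by (subst thompson_le_ln_iff) auto
      qed
      moreover have "0 < ln U" "ln U < t" "t < ln T"
      proof -
        show "0 < ln U"
          using U1 by simp
        have "ln U < ln (exp t)"
          using U1 h by (subst ln_less_cancel_iff) (auto simp: U_def)
        then show "ln U < t"
          by simp
        have "ln (exp t) < ln T"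
          using T1 by (subst ln_less_cancel_iff) (auto intro: less_trans[OF exp_gt_zero])
        then show "t < ln T"
          by simp
      qed
      ultimately show "\<exists>u t'. 0 < u \<and> u < t \<and> t < t' \<and> (\<forall>a\<in>A. \<forall>b\<in>A.
          thompson C (f a) (f b) \<le> s \<longrightarrow> thompson C a b \<le> t' \<longrightarrow> thompson C (g a) (g b) \<le> u)"
        by (intro exI[of _ "ln U"] exI[of _ "ln T"]) auto
    qed
    \<comment> \<open>Chosen so that a Thompson cover of size \<open>ln \<beta>\<close>, cut down to
      \<open>A\<close>, is a norm cover of size \<open>e\<close>.\<close>
    define \<beta> where "\<beta> = 1 + e / L"
    have b: "\<beta> > 1" "L * (\<beta> - 1) = e"
      using \<open>e > 0\<close> L(1) by (auto simp: \<beta>_def)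
    then obtain F where F: "finite F" "A \<subseteq> \<Union>F"
      "\<forall>S\<in>F. \<forall>a\<in>S. \<forall>b\<in>S. thompson C a b \<le> ln \<beta>"
      using cover[of "ln \<beta>"] unfolding finite_cover_le_def by auto
    have "dist a b \<le> e" if "S \<in> F" "a \<in> S \<inter> A" "b \<in> S \<inter> A" for S a b
    proof -
      have "order_close C \<beta> a b"
        using that F(3) A_int b by (subst thompson_le_ln_iff[symmetric]) auto
      then have "dist a b \<le> L * (\<beta> - 1)"
        using that b by (intro L) (auto simp: A_def x_p)
      then show ?thesis
        using b by simp
    qed
    then show ?thesis
      unfolding finite_cover_le_def using F(1,2)
      by (intro exI[of _ "(\<lambda>S. S \<inter> A) ` F"]) auto
  qed
  have "compact (closure A)"
    using precompact by (rule compact_closure_finite_cover_le)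
  moreover have "\<forall>n. x n \<in> closure A"
    using closure_subset[of A] by (auto simp: A_def)
  ultimately obtain q \<phi> where \<phi>: "strict_mono \<phi>" and lim: "(x \<circ> \<phi>) \<longlonglongrightarrow> q"
    unfolding compact_eq_seq_compact_metric by (rule seq_compactE) auto
  \<comment> \<open>The order bounds survive the limit as \<open>C\<close> is closed. They place
    \<open>q\<close> above \<open>p / R\<close>, hence in the interior, and make the norm estimate
    \<open>L\<close> applicable to \<open>q\<close>.\<close>
  have q_p: "order_close C R q p"
    unfolding order_close_def
  proof
    have "(\<lambda>n. R *\<^sub>R p - (x \<circ> \<phi>) n) \<longlonglongrightarrow> R *\<^sub>R p - q"
      by (intro tendsto_intros lim)
    then show "R *\<^sub>R p - q \<in> C"
      by (rule closed_sequentially[OF closed, rotated]) (use x_p in \<open>simp add: order_close_def\<close>)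
    have "(\<lambda>n. R *\<^sub>R (x \<circ> \<phi>) n - p) \<longlonglongrightarrow> R *\<^sub>R q - p"
      by (intro tendsto_intros lim)
    then show "R *\<^sub>R q - p \<in> C"
      by (rule closed_sequentially[OF closed, rotated]) (use x_p in \<open>simp add: order_close_def\<close>)
  qed
  have q_int: "q \<in> interior C"
  proof (rule interior_upward[OF p(1)])
    show "0 < 1 / R"
      using R by simp
    have "(1 / R) *\<^sub>R (R *\<^sub>R q - p) \<in> C"
      using R q_p by (intro scale_mem) (auto simp: order_close_def)
    then show "q - (1 / R) *\<^sub>R p \<in> C"
      using R by (simp add: scaleR_diff_right)
  qed
  have "(\<lambda>n. x n - x (Suc n)) \<longlonglongrightarrow> 0"
  proof (rule LIMSEQ_I)
    fix e :: real
    assume "e > 0"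
    define \<beta> where "\<beta> = 1 + e / (2 * L)"
    have b: "\<beta> > 1" "L * (\<beta> - 1) < e"
      using \<open>e > 0\<close> L(1) by (auto simp: \<beta>_def)
    have "\<exists>m. \<forall>n\<ge>m. order_close C \<beta> (x n) (x (Suc n))"
    proof (rule averaged_asymptotically_regular[where y = "\<lambda>n. f (x n)", OF intC[OF x_int] iter alpha])
      \<comment> \<open>The maximum ensures that the target factor does not exceed the orbit
        bound.\<close>
      show "order_close C (max B \<beta>) (x m) (x n)" for m n
        by (rule order_close_mono[OF near[OF x_p x_p]]) (auto simp: intC x_int)
    qed (use b close_f x_int in auto)
    then obtain m where m: "\<And>n. n \<ge> m \<Longrightarrow> order_close C \<beta> (x n) (x (Suc n))"
      by blast
    have "norm (x n - x (Suc n) - 0) < e" if "n \<ge> m" for n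
      using L(2)[OF x_p x_p _ m[OF that]] b by (simp add: dist_norm)
    then show "\<exists>m. \<forall>n\<ge>m. norm (x n - x (Suc n) - 0) < e"
      by blast
  qed
  \<comment> \<open>Dividing by \<open>\<alpha>\<close> is exact:
    \<open>x n - x (Suc n) = \<alpha> (x n - f (x n))\<close>.\<close>
  then have "(\<lambda>n. (1 / \<alpha>) *\<^sub>R ((\<lambda>n. x n - x (Suc n)) \<circ> \<phi>) n) \<longlonglongrightarrow> (1 / \<alpha>) *\<^sub>R 0"
    using \<phi> by (intro tendsto_intros LIMSEQ_subseq_LIMSEQ)
  then have "(\<lambda>n. (x \<circ> \<phi>) n - f ((x \<circ> \<phi>) n)) \<longlonglongrightarrow> 0"
    using alpha by (simp add: iter algebra_simps)
  moreover have "(\<lambda>n. (x \<circ> \<phi>) n - f ((x \<circ> \<phi>) n)) \<longlonglongrightarrow> q - f q"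
    by (intro tendsto_diff lim continuous_on_tendsto_compose[OF f_cont lim q_int]) (simp add: x_int)
  ultimately have fq: "f q = q"
    using LIMSEQ_unique by fastforce
  \<comment> \<open>One iterate of the subsequence near \<open>q\<close> in norm is order close to
    \<open>q\<close>; all later iterates stay so by \<open>toward_fixed\<close>, and normality
    returns to the norm.\<close>
  have "x \<longlonglongrightarrow> q"
  proof (rule metric_LIMSEQ_I)
    fix e :: real
    assume "e > 0"
    define \<beta> where "\<beta> = 1 + e / (2 * L)"
    have b: "\<beta> > 1" "L * (\<beta> - 1) < e"
      using \<open>e > 0\<close> L(1) by (auto simp: \<beta>_def)
    obtain d where d: "d > 0" "\<And>a. dist a q < d \<Longrightarrow> order_close C \<beta> a q"
      using order_close_near[OF q_int b(1)] by blast
    obtain k where "dist ((x \<circ> \<phi>) k) q < d"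
      using metric_LIMSEQ_D[OF lim d(1)] by blast
    then have "order_close C \<beta> (x (\<phi> k)) q"
      using d(2) by simp
    then have close: "order_close C \<beta> (x n) q" if "n \<ge> \<phi> k" for n
      using toward_fixed[OF q_int fq _ _ that] b by simp
    have "dist (x n) q < e" if "n \<ge> \<phi> k" for n
      using L(2)[OF x_p q_p _ close[OF that]] b by simp
    then show "\<exists>m. \<forall>n\<ge>m. dist (x n) q < e"
      by blast
  qed
  with q_int fq show ?thesis
    by blast
qed

end
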